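(* For every integer $k\ge1$, $$S_{1,\lambda}^{Y}(k,k)=\big(\kappa_{1,\lambda}(Y)\big)^{k}.$$
   Context: $\lambda$ is a fixed nonzero real number. For real $x$: $(x)_{0,\lambda}=1$, $(x)_{n,\lambda}=x(x-\lambda)\cdots(x-(n-1)\lambda)$ for $n\ge1$. The degenerate exponential is $e_{\lambda}^{x}(t)=(1+\lambda t)^{x/\lambda}=\sum_{n\ge0}(x)_{n,\lambda}\frac{t^n}{n!}$. The degenerate logarithm is, for $\mu\ne0$ and $u>0$, $\log_{\mu}(u)=\frac{1}{\mu}(u^{\mu}-1)$; in particular $\log_{-\lambda}(u)=-\frac1\lambda(u^{-\lambda}-1)$. $Y$ is a real random variable whose degenerate moment generating functions exist near the origin: for every nonzero real $\lambda$ there is $r=r(\lambda)>0$ with $E[e_{\lambda}^{Y}(t)]=\sum_{n\ge0}E[(Y)_{n,\lambda}]\frac{t^n}{n!}$ for $|t|<r$. All generating-function identities are power series expansions at $t=0$. The numbers $\kappa_{n,\lambda}(Y)$ are defined by $\log_{-\lambda}\big(E[e_{\lambda}^{Y}(t)]\big)=\sum_{n\ge0}\kappa_{n,\lambda}(Y)\frac{t^n}{n!}$. Probabilistic degenerate Stirling numbers of the first kind: $\frac{1}{k!}\big(\log_{-\lambda}(E[e_{\lambda}^{Y}(t)])\big)^k=\sum_{n\ge k}(-1)^{n-k}S_{1,\lambda}^{Y}(n,k)\frac{t^n}{n!}$, $k\ge0$. *)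

theory Defs
  imports "HOL-Probability.Probability"
begin

definition degen_falling :: "real \<Rightarrow> real \<Rightarrow> nat \<Rightarrow> real" where
  "degen_falling lam x n = (\<Prod>i<n. x - real i * lam)"

(* Only meaningful for lam \<noteq> 0 and 1 + lam * t > 0. *)
definition degen_exp :: "real \<Rightarrow> real \<Rightarrow> real \<Rightarrow> real" where
  "degen_exp lam x t = (1 + lam * t) powr (x / lam)"

(* Only meaningful for mu \<noteq> 0 and u > 0. *)
definition degen_log :: "real \<Rightarrow> real \<Rightarrow> real" where
  "degen_log mu u = (u powr mu - 1) / mu"

definition degen_mgf :: "'a measure \<Rightarrow> ('a \<Rightarrow> real) \<Rightarrow> real \<Rightarrow> real \<Rightarrow> real" where
  "degen_mgf M Y lam t = (\<integral>\<omega>. degen_exp lam (Y \<omega>) t \<partial>M)"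

(* The Bochner integral of a non-integrable function is 0, so the existence of the
   expectations has to be required explicitly.  The clause 1 + lam * t > 0 keeps the real
   power in its domain; it only restricts r to r \<le> 1 / \<bar>lam\<bar>. *)
definition degen_mgfs_exist :: "'a measure \<Rightarrow> ('a \<Rightarrow> real) \<Rightarrow> bool" where
  "degen_mgfs_exist M Y \<longleftrightarrow>
    (\<forall>lam. lam \<noteq> 0 \<longrightarrow>
      (\<forall>n. integrable M (\<lambda>\<omega>. degen_falling lam (Y \<omega>) n)) \<and>
      (\<exists>r>0. \<forall>t. \<bar>t\<bar> < r \<longrightarrow>
         1 + lam * t > 0 \<and>
         integrable M (\<lambda>\<omega>. degen_exp lam (Y \<omega>) t) \<and>
         (\<lambda>n. (\<integral>\<omega>. degen_falling lam (Y \<omega>) n \<partial>M) * t ^ n / fact n)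
           sums degen_mgf M Y lam t))"

(* The coefficients a n in f t = (\<Sum>n. a n * t ^ n / fact n) for t near 0.  The description
   is unique whenever f has a power series expansion at 0, see egf_coeff_eqI below;
   for other f the value is unspecified. *)
definition egf_coeff :: "(real \<Rightarrow> real) \<Rightarrow> nat \<Rightarrow> real" where
  "egf_coeff f = (THE a. f has_fps_expansion Abs_fps (\<lambda>n. a n / fact n))"

definition degen_cumulant :: "'a measure \<Rightarrow> ('a \<Rightarrow> real) \<Rightarrow> real \<Rightarrow> nat \<Rightarrow> real" where
  "degen_cumulant M Y lam n = egf_coeff (\<lambda>t. degen_log (- lam) (degen_mgf M Y lam t)) n"

(* From (1 / k!) * log^k = (\<Sum>n\<ge>k. (-1)^(n-k) * S(n,k) * t^n / n!), solved for S(n,k).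
   The series starts at n = k because the mgf is 1 at t = 0, so that its degenerate
   logarithm vanishes there; n < k is outside the intended domain of S. *)
definition prob_degen_stirling1 ::
    "'a measure \<Rightarrow> ('a \<Rightarrow> real) \<Rightarrow> real \<Rightarrow> nat \<Rightarrow> nat \<Rightarrow> real" where
  "prob_degen_stirling1 M Y lam n k =
    (-1) ^ (n - k) *
    egf_coeff (\<lambda>t. 1 / fact k * (degen_log (- lam) (degen_mgf M Y lam t)) ^ k) n"

lemma real_has_fps_expansion_unique:
  fixes f :: "real \<Rightarrow> real"
  assumes "f has_fps_expansion F" and "f has_fps_expansion G"
  shows "F = G"
proof (rule fps_ext)
  fix n
  show "fps_nth F n = fps_nth G n"
    using assms
  proof (induction n arbitrary: f F G)
    case 0
    from "0.prems" have "eval_fps F 0 = f 0" "eval_fps G 0 = f 0"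
      by (auto simp: has_fps_expansion_def dest: eventually_nhds_x_imp_x)
    then show ?case by (simp add: eval_fps_at_0)
  next
    case (Suc n)
    have "fps_nth (fps_deriv F) n = fps_nth (fps_deriv G) n"
      by (rule Suc.IH[of "deriv f"]) (intro has_fps_expansion_deriv Suc.prems)+
    then show ?case by (simp del: of_nat_Suc)
  qed
qed

lemma egf_coeff_eqI:
  assumes "f has_fps_expansion Abs_fps (\<lambda>n. a n / fact n)"
  shows "egf_coeff f = a"
  unfolding egf_coeff_def
proof (rule the_equality)
  fix b assume "f has_fps_expansion Abs_fps (\<lambda>n. b n / fact n)"
  from real_has_fps_expansion_unique[OF this assms] show "b = a"
    by (auto simp: fps_eq_iff fun_eq_iff)
qed (fact assms)

end

theory Submission
  imports Defs "HOL-Complex_Analysis.Complex_Analysis"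
begin

text \<open>
  If a function \<open>f\<close> has a power series expansion at \<open>0\<close> and vanishes there, then the
  coefficient of \<open>t ^ k\<close> in \<open>f ^ k\<close> is the \<open>k\<close>-th power of the coefficient of \<open>t\<close> in \<open>f\<close>.
  The moment generating function is \<open>1\<close> at \<open>0\<close>, so this applies to its degenerate logarithm,
  whose expansion comes from complex analysis: extend the mgf to a holomorphic function
  near \<open>0\<close>, take the complex power, and read off real parts of the coefficients.
\<close>

text \<open>The extension \<open>g\<close> is the sum of the same series at complex arguments. It
  converges on a disc around 0 because the radius of convergence depends only on the norms of the
  coefficients.\<close>

lemma has_fps_expansion_complexify:
  fixes f :: "real \<Rightarrow> real"
  assumes "f has_fps_expansion F"
  obtains g :: "complex \<Rightarrow> complex"
  where "g has_fps_expansion Abs_fps (\<lambda>n. of_real (fps_nth F n))"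
    and "eventually (\<lambda>x. g (of_real x) = of_real (f x)) (nhds 0)"
proof
  let ?G = "Abs_fps (\<lambda>n. of_real (fps_nth F n) :: complex)"
  have radius: "fps_conv_radius ?G = fps_conv_radius F"
    by (simp add: fps_conv_radius_def conv_radius_def)
  have pos: "fps_conv_radius F > 0"
    using assms by (simp add: has_fps_expansion_def)
  show "eval_fps ?G has_fps_expansion ?G"
    using pos radius by (intro eval_fps_has_fps_expansion) simp
  have "eventually (\<lambda>x. x \<in> eball 0 (fps_conv_radius F)) (nhds 0)"
    using pos by (intro eventually_nhds_in_open) (auto simp: zero_ereal_def)
  moreover have "eventually (\<lambda>x. eval_fps F x = f x) (nhds 0)"
    using assms by (simp add: has_fps_expansion_def)
  ultimately show "eventually (\<lambda>x. eval_fps ?G (of_real x) = of_real (f x)) (nhds 0)"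
  proof eventually_elim
    case (elim x)
    then have "(\<lambda>n. fps_nth F n * x ^ n) sums f x"
      using sums_eval_fps[of x F] by simp
    then have "(\<lambda>n. complex_of_real (fps_nth F n * x ^ n)) sums of_real (f x)"
      by (rule sums_of_real)
    then show ?case
      by (simp add: eval_fps_def sums_iff)
  qed
qed

text \<open>On the real axis the powers of the argument are real, so taking real parts termwise acts
  on the coefficients alone. This avoids a separate proof that the coefficients of \<open>F\<close>
  are real.\<close>

lemma has_fps_expansion_Re:
  fixes f :: "complex \<Rightarrow> complex" and g :: "real \<Rightarrow> real"
  assumes "f has_fps_expansion F"
    and "eventually (\<lambda>x. f (of_real x) = of_real (g x)) (nhds 0)"
  shows "g has_fps_expansion Abs_fps (\<lambda>n. Re (fps_nth F n))"
proof (rule has_fps_expansionI)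
  have lim: "filterlim complex_of_real (nhds 0) (nhds 0)"
    using tendsto_of_real[OF tendsto_ident_at, of "0::real" UNIV]
    by (simp add: tendsto_nhds_iff)
  have "eventually (\<lambda>z. z \<in> eball 0 (fps_conv_radius F)) (nhds 0)"
    using assms(1) by (intro eventually_nhds_in_open) (auto simp: has_fps_expansion_def zero_ereal_def)
  moreover have "eventually (\<lambda>z. eval_fps F z = f z) (nhds 0)"
    using assms(1) by (simp add: has_fps_expansion_def)
  ultimately have "eventually (\<lambda>z. (\<lambda>n. fps_nth F n * z ^ n) sums f z) (nhds 0)"
  proof eventually_elim
    case (elim z)
    then show ?case using sums_eval_fps[of z F] by simp
  qed
  then have "eventually (\<lambda>x. (\<lambda>n. fps_nth F n * of_real x ^ n) sums f (of_real x)) (nhds 0)"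
    using lim by (rule eventually_compose_filterlim)
  with assms(2) show "eventually
      (\<lambda>x. (\<lambda>n. fps_nth (Abs_fps (\<lambda>n. Re (fps_nth F n))) n * x ^ n) sums g x) (nhds 0)"
  proof eventually_elim
    case (elim x)
    then have "(\<lambda>n. Re (fps_nth F n * of_real x ^ n)) sums Re (f (of_real x))"
      by (intro sums_Re)
    with elim(1) show ?case
      by (simp flip: of_real_power)
  qed
qed

text \<open>Only the existence of an expansion matters later, so \<open>H\<close> stays unspecified.
  It comes from the principal branch of the complex power, which is analytic off the nonpositive
  reals; \<open>f 0 > 0\<close> keeps the base off this cut.\<close>

lemma has_fps_expansion_powr_real:
  fixes f :: "real \<Rightarrow> real"
  assumes "f has_fps_expansion F" and "f 0 > 0"
  obtains H where "(\<lambda>x. f x powr c) has_fps_expansion H"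
proof -
  obtain g :: "complex \<Rightarrow> complex" where
    g: "g has_fps_expansion Abs_fps (\<lambda>n. of_real (fps_nth F n))"
    and gf: "eventually (\<lambda>x. g (of_real x) = of_real (f x)) (nhds 0)"
    using has_fps_expansion_complexify[OF assms(1)] .
  have "g 0 = of_real (f 0)"
    using eventually_nhds_x_imp_x[OF gf] by simp
  with assms(2) have "g 0 \<notin> \<real>\<^sub>\<le>\<^sub>0"
    by simp
  then have "(\<lambda>z. g z powr of_real c) analytic_on {0}"
    using has_fps_expansion_imp_analytic_0[OF g] by (intro analytic_intros) auto
  then obtain H where H: "(\<lambda>z. g z powr of_real c) has_fps_expansion H"
    using analytic_at_imp_has_fps_expansion_0 by blast
  \<comment> \<open>Positivity is needed on a whole neighbourhood of 0: there the complex power of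
    the real base is identified with the real \<open>powr\<close>.\<close>
  have "isCont f 0"
    using has_fps_expansion_imp_continuous[OF assms(1), of UNIV] by simp
  then have "(f \<longlongrightarrow> f 0) (nhds 0)"
    by (simp add: isCont_def tendsto_nhds_iff)
  then have "eventually (\<lambda>x. f x > 0) (nhds 0)"
    using assms(2) by (rule order_tendstoD)
  with gf have "eventually (\<lambda>x. g (of_real x) powr of_real c = of_real (f x powr c)) (nhds 0)"
    by eventually_elim (simp add: powr_of_real)
  from has_fps_expansion_Re[OF H this] that show ?thesis
    by blast
qed

lemma egf_coeff_eq:
  assumes "f has_fps_expansion F"
  shows "egf_coeff f n = fact n * fps_nth F n"
proof -
  have "egf_coeff f = (\<lambda>n. fact n * fps_nth F n)"
    using assms by (intro egf_coeff_eqI) (simp add: fps_nth_inverse)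
  then show ?thesis
    by simp
qed

lemma degen_mgf_has_fps_expansion:
  assumes "degen_mgfs_exist M Y" and "lam \<noteq> 0"
  shows "degen_mgf M Y lam has_fps_expansion
    Abs_fps (\<lambda>n. (\<integral>\<omega>. degen_falling lam (Y \<omega>) n \<partial>M) / fact n)"
proof (rule has_fps_expansionI)
  obtain r where r: "r > 0"
    "\<And>t. \<bar>t\<bar> < r \<Longrightarrow> (\<lambda>n. (\<integral>\<omega>. degen_falling lam (Y \<omega>) n \<partial>M) * t ^ n / fact n)
      sums degen_mgf M Y lam t"
    using assms unfolding degen_mgfs_exist_def by blast
  have "eventually (\<lambda>t. t \<in> ball 0 r) (nhds 0)"
    using r(1) by (intro eventually_nhds_in_open) auto
  then show "eventually (\<lambda>t. (\<lambda>n. fps_nth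
      (Abs_fps (\<lambda>n. (\<integral>\<omega>. degen_falling lam (Y \<omega>) n \<partial>M) / fact n)) n * t ^ n)
      sums degen_mgf M Y lam t) (nhds 0)"
    by eventually_elim (use r(2) in simp)
qed

lemma (in prob_space) degen_mgf_0 [simp]: "degen_mgf M Y lam 0 = 1"
  by (simp add: degen_mgf_def degen_exp_def prob_space)

theorem corollary2p8:
  fixes M :: "'a measure" and Y :: "'a \<Rightarrow> real" and lam :: real and k :: nat
  assumes "prob_space M"
    and "Y \<in> borel_measurable M"
    and "degen_mgfs_exist M Y"
    and "lam \<noteq> 0"
    and "k \<ge> 1"
  shows "prob_degen_stirling1 M Y lam k k = (degen_cumulant M Y lam 1) ^ k"
proof -
  interpret prob_space M by fact
  let ?L = "\<lambda>t. degen_log (- lam) (degen_mgf M Y lam t)"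
  obtain H where "(\<lambda>t. degen_mgf M Y lam t powr (- lam)) has_fps_expansion H"
    using has_fps_expansion_powr_real[OF degen_mgf_has_fps_expansion[OF assms(3,4)]] by auto
  \<comment> \<open>Division by \<open>- lam\<close> appears as multiplication by a constant, so the
    expansion is built from a difference and a product.\<close>
  then have "(\<lambda>t. (degen_mgf M Y lam t powr (- lam) - 1) * inverse (- lam))
      has_fps_expansion (H - 1) * fps_const (inverse (- lam))"
    by (intro fps_expansion_intros)
  then obtain L where L: "?L has_fps_expansion L"
    unfolding degen_log_def divide_inverse by blast
  have "fps_nth L 0 = 0"
    using has_fps_expansion_imp_0_eq_fps_nth_0[OF L] by (simp add: degen_log_def)
  \<comment> \<open>Each of the \<open>k\<close> factors contributes degree at least 1, so degree
    \<open>k\<close> arises only by taking the linear term from every factor.\<close>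
  then have "fps_nth (L ^ k) k = fps_nth L 1 ^ k"
    by (rule startsby_zero_power_nth_same)
  moreover have "(\<lambda>t. 1 / fact k * ?L t ^ k) has_fps_expansion fps_const (1 / fact k) * L ^ k"
    by (intro fps_expansion_intros L)
  \<comment> \<open>The \<open>fact k\<close> from \<open>egf_coeff\<close> cancels
    \<open>1 / fact k\<close>, the sign has exponent \<open>k - k = 0\<close>, and
    \<open>fact 1 = 1\<close> makes the first cumulant the linear coefficient of
    \<open>L\<close>.\<close>
  ultimately show ?thesis
    unfolding prob_degen_stirling1_def degen_cumulant_def
    by (simp add: egf_coeff_eq[OF L] egf_coeff_eq)
qed

end
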